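(* Let $H$ be a Hilbert $C^*$-module and $Q\in\mathcal{L}(H)$ a non-projection idempotent. Then the operators $(I-m(Q))Q$, $Q(I-m(Q))$, $(I-Q)m(Q)$, $m(Q)(I-Q)$ all have norm $\frac{\sqrt2}{2}\sqrt{\|Q\|(\|Q\|-1)}$. Furthermore, $$\big\|(m(Q)-Q)^2\big\|=\frac{\|Q\|-1}{2},\qquad \|m(Q)-Q\|=\frac12\Big(\|Q\|-1+\sqrt{\|Q\|^2-1}\Big).$$ Consequently, $$\sqrt2\,\big\|(m(Q)-Q)^2\big\|<\big\|(I-m(Q))Q\big\|<\|m(Q)-Q\|<\sqrt2\,\big\|(I-m(Q))Q\big\|.$$
   Context: $H$ is a Hilbert module over a $C^*$-algebra, $\mathcal{L}(H)$ the adjointable operators; a non-projection idempotent is $Q$ with $Q^2=Q\neq Q^*$. For $T$, $|T|=(T^*T)^{1/2}$ and $T^\dagger$ is the Moore–Penrose inverse (exists iff $\mathcal{R}(T)$ is closed). The matched projection of an idempotent $Q$ is $m(Q)=\tfrac12(|Q^*|+Q^* )|Q^*|^\dagger(|Q^*|+I)^{-1}(|Q^*|+Q)$. *)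

theory Defs
  imports Complex_Main
begin

text \<open>The adjointable operators L(H) on a Hilbert C*-module H form a unital (complex)
C*-algebra, and every unital C*-algebra A arises this way (A = L(A_A)).  We therefore
work in an abstract unital complex C*-algebra, given as a type class.\<close>

class cstar_algebra = banach + real_normed_algebra_1 +
  fixes scaleC :: "complex \<Rightarrow> 'a \<Rightarrow> 'a"
    and adj :: "'a \<Rightarrow> 'a"
  assumes scaleC_of_real: "scaleC (complex_of_real r) x = scaleR r x"
    and scaleC_add_left: "scaleC (a + b) x = scaleC a x + scaleC b x"
    and scaleC_add_right: "scaleC a (x + y) = scaleC a x + scaleC a y"
    and scaleC_scaleC: "scaleC a (scaleC b x) = scaleC (a * b) x"
    and scaleC_one: "scaleC 1 x = x"
    and norm_scaleC: "norm (scaleC a x) = cmod a * norm x"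
    and scaleC_mult_left: "scaleC a (x * y) = scaleC a x * y"
    and scaleC_mult_right: "scaleC a (x * y) = x * scaleC a y"
    and adj_adj: "adj (adj x) = x"
    and adj_add: "adj (x + y) = adj x + adj y"
    and adj_mult: "adj (x * y) = adj y * adj x"
    and adj_scaleC: "adj (scaleC a x) = scaleC (cnj a) (adj x)"
    and cstar_identity: "norm (adj x * x) = (norm x)\<^sup>2"

definition invertible_el :: "'a::cstar_algebra \<Rightarrow> bool" where
  "invertible_el x \<longleftrightarrow> (\<exists>y. x * y = 1 \<and> y * x = 1)"

definition inv_el :: "'a::cstar_algebra \<Rightarrow> 'a" where
  "inv_el x = (THE y. x * y = 1 \<and> y * x = 1)"

definition spectrum_el :: "'a::cstar_algebra \<Rightarrow> complex set" where
  "spectrum_el x = {z. \<not> invertible_el (x - scaleC z 1)}"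

definition positive_el :: "'a::cstar_algebra \<Rightarrow> bool" where
  "positive_el x \<longleftrightarrow> adj x = x \<and> spectrum_el x \<subseteq> complex_of_real ` {0..}"

definition sqrt_el :: "'a::cstar_algebra \<Rightarrow> 'a" where
  "sqrt_el x = (THE y. positive_el y \<and> y * y = x)"

definition abs_el :: "'a::cstar_algebra \<Rightarrow> 'a" where
  "abs_el T = sqrt_el (adj T * T)"

definition mp_inv :: "'a::cstar_algebra \<Rightarrow> 'a" where
  "mp_inv T = (THE X. T * X * T = T \<and> X * T * X = X \<and> adj (T * X) = T * X \<and> adj (X * T) = X * T)"

definition matched_proj :: "'a::cstar_algebra \<Rightarrow> 'a" where
  "matched_proj Q = scaleR (1/2)
     ((abs_el (adj Q) + adj Q) * mp_inv (abs_el (adj Q)) * inv_el (abs_el (adj Q) + 1)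
      * (abs_el (adj Q) + Q))"

end

theory Submission
  imports Defs
begin

text \<open>
  The element \<open>h = Q + Q\<^sup>* - 1\<close> is self-adjoint, \<open>k = Q - Q\<^sup>*\<close> is skew-adjoint, and
  \<open>h\<^sup>2 = 1 - k\<^sup>2 \<ge> 1\<close>, \<open>h k = - k h\<close>. The modulus \<open>a = |h|\<close> commutes with \<open>Q\<close> and \<open>Q\<^sup>*\<close>, and
  \<open>|Q\<^sup>*| = P a\<close> for the range projection \<open>P = Q Q\<^sup>* a\<^bsup>-2\<^esup>\<close>. The formula for the matched projection
  then collapses to \<open>m(Q) = (1 + u) / 2\<close> with the symmetry \<open>u = h a\<^bsup>-1\<^esup>\<close>; in particular
  \<open>m(Q\<^sup>*) = m(Q)\<close> and \<open>m(1 - Q) = 1 - m(Q)\<close>, which makes one of the four products stand for all.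
  Both \<open>P\<close> and \<open>1 - m(Q)\<close> swap with their complements when moved past \<open>k\<close>, hence compressing
  \<open>a\<^sup>2 = 1 - k\<^sup>2\<close> to either of them preserves its norm. This gives \<open>norm Q = norm a\<close> from
  \<open>Q Q\<^sup>* = P a\<^sup>2\<close>, and the norm of \<open>(1 - m(Q)) Q\<close>, whose squared modulus is the compression of
  \<open>(a\<^sup>2 - a) / 2\<close>. Finally \<open>(m(Q) - Q)\<^sup>2 = (1 - a) / 2\<close> and \<open>2 (m(Q) - Q) u = 1 - (a + k u)\<close>, where
  \<open>k u\<close> is self-adjoint with square \<open>a\<^sup>2 - 1\<close>.
\<close>

subsection \<open>The involution\<close>

abbreviation selfadjoint :: "'a::cstar_algebra \<Rightarrow> bool" where
  "selfadjoint x \<equiv> adj x = x"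

abbreviation skewadjoint :: "'a::cstar_algebra \<Rightarrow> bool" where
  "skewadjoint x \<equiv> adj x = - x"

lemma adj_zero [simp]: "adj (0::'a::cstar_algebra) = 0"
  using adj_add[of "0::'a" 0] by simp

lemma adj_minus [simp]: "adj (- x) = - adj (x::'a::cstar_algebra)"
  using adj_add[of x "- x"] by (simp add: eq_neg_iff_add_eq_0 add.commute)

lemma adj_diff: "adj (x - y) = adj x - adj (y::'a::cstar_algebra)"
  using adj_add[of x "- y"] by simp

lemma adj_one [simp]: "adj (1::'a::cstar_algebra) = 1"
  using adj_mult[of "adj (1::'a)" 1] by (simp add: adj_adj)

lemma adj_scaleR: "adj (r *\<^sub>R x) = r *\<^sub>R adj (x::'a::cstar_algebra)"
  using adj_scaleC[of "complex_of_real r" x] by (simp add: scaleC_of_real)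

lemma adj_of_real [simp]: "adj (of_real r :: 'a::cstar_algebra) = of_real r"
  by (simp add: of_real_def adj_scaleR)

lemma adj_power: "adj (x ^ n) = adj (x::'a::cstar_algebra) ^ n"
  by (induction n) (simp_all add: adj_mult power_commutes)

lemmas adj_simps = adj_adj adj_add adj_diff adj_mult adj_scaleR

lemma norm_le_norm_adj: "norm x \<le> norm (adj (x::'a::cstar_algebra))"
proof (cases "x = 0")
  case False
  have "norm x * norm x \<le> norm (adj x) * norm x"
    using cstar_identity[of x] norm_mult_ineq[of "adj x" x] by (simp add: power2_eq_square)
  then show ?thesis using False by simp
qed simp

lemma norm_adj [simp]: "norm (adj x) = norm (x::'a::cstar_algebra)"
  using norm_le_norm_adj[of x] norm_le_norm_adj[of "adj x"] by (simp add: adj_adj)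

lemma norm_mult_adj: "norm (x * adj x) = (norm (x::'a::cstar_algebra))\<^sup>2"
  using cstar_identity[of "adj x"] by (simp add: adj_adj)

lemma norm_selfadjoint_square: "selfadjoint x \<Longrightarrow> norm (x * x) = (norm x)\<^sup>2"
  using cstar_identity[of x] by simp

lemma bounded_linear_adj: "bounded_linear (adj :: 'a::cstar_algebra \<Rightarrow> 'a)"
  by (rule bounded_linear_intro[where K = 1]) (simp_all add: adj_simps)

lemma norm_mult_coisometry:
  fixes x u :: "'a::cstar_algebra"
  assumes "u * adj u = 1"
  shows "norm (x * u) = norm x"
proof -
  have "(x * u) * adj (x * u) = x * (u * adj u) * adj x" by (simp add: adj_mult mult.assoc)
  then have "(norm (x * u))\<^sup>2 = (norm x)\<^sup>2" using assms by (simp flip: norm_mult_adj)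
  then show ?thesis by simp
qed

lemma norm_isometry_mult:
  fixes x u :: "'a::cstar_algebra"
  assumes "adj u * u = 1"
  shows "norm (u * x) = norm x"
  using norm_mult_coisometry[of "adj u" "adj x"] norm_adj[of "u * x"] assms
  by (simp add: adj_adj adj_mult)

subsection \<open>Complex multiples of the unit\<close>

lemma scaleC_of_real_one [simp]: "scaleC (complex_of_real r) (1::'a::cstar_algebra) = of_real r"
  by (subst scaleC_of_real) (simp add: of_real_def)

lemma scaleC_minus_left: "scaleC (- c) x = - scaleC c (x::'a::cstar_algebra)"
  using scaleC_add_left[of c "- c" x] scaleC_of_real[of 0 x]
  by (simp add: eq_neg_iff_add_eq_0 add.commute)

lemma scaleC_minus_right: "scaleC c (- x) = - scaleC c (x::'a::cstar_algebra)"
proof -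
  have "scaleC c (0::'a) = 0" using scaleC_add_right[of c 0 0] by simp
  then show ?thesis
    using scaleC_add_right[of c "- x" x] by (simp add: eq_neg_iff_add_eq_0)
qed

lemma scaleC_mult_scaleC:
  "scaleC c x * scaleC d y = scaleC (c * d) (x * (y::'a::cstar_algebra))"
  by (simp add: scaleC_mult_left[symmetric] scaleC_mult_right[symmetric] scaleC_scaleC
      mult.commute)

lemma scaleC_one_commute: "scaleC c 1 * x = x * scaleC c (1::'a::cstar_algebra)"
  by (simp flip: scaleC_mult_left scaleC_mult_right)

lemma scaleC_eq_of_real_add:
  "scaleC z (1::'a::cstar_algebra) = of_real (Re z) + scaleC (\<i> * Im z) 1"
  by (subst complex_eq[of z]) (simp only: scaleC_add_left scaleC_of_real_one)

lemma mult_minus_add_scaleC: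
  "(x - scaleC w 1) * (x + scaleC w 1) = x * x - scaleC (w * w) (1::'a::cstar_algebra)"
  by (simp add: algebra_simps scaleC_one_commute scaleC_mult_scaleC)

lemma mult_add_minus_scaleC:
  "(x + scaleC w 1) * (x - scaleC w 1) = x * x - scaleC (w * w) (1::'a::cstar_algebra)"
  by (simp add: algebra_simps scaleC_one_commute scaleC_mult_scaleC)

lemma norm_square_le_norm_sum_squares:
  fixes p q :: "'a::cstar_algebra"
  assumes p: "selfadjoint p" and q: "selfadjoint q" and pq_commute: "p * q = q * p"
  shows "(norm p)\<^sup>2 \<le> norm (p * p + q * q)"
proof -
  define v where "v = p + scaleC \<i> q"
  have adj_v: "adj v = p - scaleC \<i> q"
    by (simp add: v_def adj_simps adj_scaleC p q scaleC_minus_left)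
  have commute: "scaleC \<i> q * p = p * scaleC \<i> q"
    by (simp add: pq_commute flip: scaleC_mult_left scaleC_mult_right)
  have "adj v * v = p * p + q * q"
    by (simp add: adj_v)
      (simp add: v_def algebra_simps commute scaleC_mult_scaleC scaleC_minus_left scaleC_one)
  then have norm_v: "(norm v)\<^sup>2 = norm (p * p + q * q)" using cstar_identity[of v] by simp
  have "2 *\<^sub>R p = v + adj v" by (simp add: adj_v) (simp add: v_def scaleR_2)
  then have "norm (2 *\<^sub>R p) \<le> norm v + norm (adj v)" by (simp only: norm_triangle_ineq)
  then have "(norm p)\<^sup>2 \<le> (norm v)\<^sup>2" by (intro power_mono) auto
  then show ?thesis by (simp only: norm_v)
qed

subsection \<open>Invertible elements\<close>

lemma commute_left: "x * y = y * x \<Longrightarrow> x * (y * z) = y * (x * (z::'a::semigroup_mult))"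
  by (metis mult.assoc)

lemma left_inverse_eq_right_inverse:
  fixes x :: "'a::monoid_mult"
  assumes "y * x = 1" "x * z = 1"
  shows "y = z"
  using assms by (metis mult.assoc mult_1_left mult_1_right)

lemma invertible_elI: "x * y = 1 \<Longrightarrow> y * x = 1 \<Longrightarrow> invertible_el x"
  by (auto simp: invertible_el_def)

lemma inv_el_eqI: "x * y = 1 \<Longrightarrow> y * x = 1 \<Longrightarrow> inv_el x = y"
  unfolding inv_el_def by (rule the_equality) (auto intro: left_inverse_eq_right_inverse)

lemma
  assumes "invertible_el x"
  shows mult_inv_el: "x * inv_el x = 1" and inv_el_mult: "inv_el x * x = 1"
  using assms inv_el_eqI unfolding invertible_el_def by metis+

lemma invertible_el_mult:
  assumes "invertible_el x" "invertible_el y"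
  shows "invertible_el (x * y)"
proof (rule invertible_elI)
  have "x * y * (inv_el y * inv_el x) = x * (y * inv_el y) * inv_el x" by (simp only: mult.assoc)
  then show "x * y * (inv_el y * inv_el x) = 1" by (simp add: mult_inv_el assms)
  have "inv_el y * inv_el x * (x * y) = inv_el y * (inv_el x * x) * y" by (simp only: mult.assoc)
  then show "inv_el y * inv_el x * (x * y) = 1" by (simp add: inv_el_mult assms)
qed

lemma invertible_el_factor:
  assumes "x * y = y * x" "invertible_el (x * y)"
  shows "invertible_el x"
proof -
  define z where "z = inv_el (x * y)"
  have right: "x * (y * z) = 1"
    using mult_inv_el[OF assms(2)] by (simp add: z_def mult.assoc)
  have left: "z * y * x = 1"
    using inv_el_mult[OF assms(2)] by (simp add: z_def mult.assoc assms(1))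
  show ?thesis
    using left right left_inverse_eq_right_inverse[OF left right]
    by (intro invertible_elI[of x "y * z"]) simp_all
qed

lemma inv_el_commute:
  assumes inv: "invertible_el x" and "c * x = x * c"
  shows "c * inv_el x = inv_el x * c"
proof -
  have "c * inv_el x = inv_el x * (x * c) * inv_el x"
    by (simp add: inv_el_mult[OF inv] flip: mult.assoc)
  also have "\<dots> = inv_el x * c * (x * inv_el x)" by (simp only: assms(2)[symmetric] mult.assoc)
  finally show ?thesis by (simp add: mult_inv_el[OF inv])
qed

lemma selfadjoint_inv_el:
  assumes x: "selfadjoint x" and inv: "invertible_el x"
  shows "selfadjoint (inv_el x)"
proof (rule left_inverse_eq_right_inverse)
  show "adj (inv_el x) * x = 1"
    using arg_cong[OF mult_inv_el[OF inv], of adj] by (simp add: adj_mult x)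
qed (rule mult_inv_el[OF inv])

lemma invertible_el_one_minus:
  fixes x :: "'a::cstar_algebra"
  assumes "norm x < 1"
  shows "invertible_el (1 - x)"
proof -
  have summable: "summable (\<lambda>n. x ^ n)"
    by (rule complete_algebra_summable_geometric[OF assms])
  let ?y = "\<Sum>n. x ^ n"
  have "?y = 1 + (\<Sum>n. x ^ Suc n)" using suminf_split_head[OF summable] by simp
  moreover have "(\<Sum>n. x ^ Suc n) = x * ?y" using suminf_mult[OF summable, of x] by simp
  moreover have "(\<Sum>n. x ^ Suc n) = ?y * x"
    using suminf_mult2[OF summable, of x] by (simp add: power_commutes)
  ultimately show ?thesis
    by (intro invertible_elI[where y = ?y]) (simp_all add: algebra_simps)
qed

lemma invertible_el_of_real: "r \<noteq> 0 \<Longrightarrow> invertible_el (of_real r)"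
  by (intro invertible_elI[of _ "of_real (1 / r)"]) (simp_all flip: of_real_mult)

lemma invertible_el_of_real_minus:
  fixes x :: "'a::cstar_algebra"
  assumes "norm x < t"
  shows "invertible_el (of_real t - x)"
proof -
  have t: "0 < t" using assms norm_ge_zero[of x] by linarith
  have "invertible_el (of_real t * (1 - (1 / t) *\<^sub>R x))"
    using t assms by (intro invertible_el_mult invertible_el_of_real invertible_el_one_minus) auto
  then show ?thesis using t by (simp add: right_diff_distrib of_real_def)
qed

subsection \<open>The binomial series of the square root\<close>

text \<open>The Taylor coefficients of \<open>\<lambda>t. sqrt (1 - t)\<close>. They are absolutely summable, so the series
  converges on the closed unit ball and yields exact square roots without functional calculus.\<close>

definition sqrt_coeff :: "nat \<Rightarrow> real" where
  "sqrt_coeff n = pochhammer (- 1 / 2) n / fact n"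

lemma sqrt_coeff_0 [simp]: "sqrt_coeff 0 = 1"
  by (simp add: sqrt_coeff_def)

lemma sqrt_coeff_Suc_nonpos: "sqrt_coeff (Suc n) \<le> 0"
  using pochhammer_nonneg[of "1 / 2 :: real" n]
  by (simp add: sqrt_coeff_def pochhammer_rec divide_le_0_iff)

lemma sum_sqrt_coeff: "(\<Sum>k\<le>n. sqrt_coeff k) = pochhammer (1 / 2) n / fact n"
proof (induction n)
  case (Suc n)
  have "pochhammer (1 / 2 :: real) n / fact n + sqrt_coeff (Suc n)
      = pochhammer (1 / 2) n * (1 / 2 + n) / fact (Suc n)"
    by (simp add: sqrt_coeff_def pochhammer_rec field_simps del: of_nat_Suc)
      (simp add: algebra_simps)
  then show ?case using Suc by (simp add: pochhammer_Suc)
qed simp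

lemma sum_minus_sqrt_coeff_le_one: "(\<Sum>k<n. - sqrt_coeff (Suc k)) \<le> 1"
proof -
  have "(\<Sum>k\<le>n. sqrt_coeff k) = 1 + (\<Sum>k<n. sqrt_coeff (Suc k))"
    by (simp add: sum.atMost_shift)
  moreover have "0 \<le> (\<Sum>k\<le>n. sqrt_coeff k)"
    by (simp add: sum_sqrt_coeff pochhammer_nonneg)
  ultimately show ?thesis by (simp add: sum_negf)
qed

lemma summable_minus_sqrt_coeff: "summable (\<lambda>n. - sqrt_coeff (Suc n))"
  by (rule summableI_nonneg_bounded[OF _ sum_minus_sqrt_coeff_le_one])
    (simp add: sqrt_coeff_Suc_nonpos)

lemma sqrt_coeff_convolution:
  "(\<Sum>k\<le>n. sqrt_coeff k * sqrt_coeff (n - k)) = (if n = 0 then 1 else if n = 1 then - 1 else 0)"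
proof -
  have "(\<Sum>k\<le>n. sqrt_coeff k * sqrt_coeff (n - k))
      = (\<Sum>k\<le>n. real (n choose k) * pochhammer (- 1 / 2) k * pochhammer (- 1 / 2) (n - k) / fact n)"
    by (intro sum.cong refl) (simp add: sqrt_coeff_def binomial_fact)
  also have "\<dots> = pochhammer (- 1) n / fact n"
    using pochhammer_binomial_sum[of "- 1 / 2 :: real" "- 1 / 2" n]
    by (simp flip: sum_divide_distrib)
  also have "\<dots> = (if n = 0 then 1 else if n = 1 then - 1 else 0)"
    by (cases n) (auto simp: pochhammer_rec pochhammer_0_left)
  finally show ?thesis .
qed

definition sqrt_one_minus :: "'a::{real_normed_algebra_1, banach} \<Rightarrow> 'a" where
  "sqrt_one_minus x = (\<Sum>n. sqrt_coeff n *\<^sub>R x ^ n)"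

lemma norm_sqrt_one_minus_term_le:
  fixes x :: "'a::real_normed_algebra_1"
  assumes "norm x \<le> 1"
  shows "norm (sqrt_coeff (Suc n) *\<^sub>R x ^ Suc n) \<le> - sqrt_coeff (Suc n)"
proof -
  have "norm (x ^ Suc n) \<le> 1"
    using norm_power_ineq[of x "Suc n"] power_le_one[OF norm_ge_zero assms] by (rule order_trans)
  then show ?thesis using mult_left_mono[of "norm (x ^ Suc n)" 1 "- sqrt_coeff (Suc n)"]
      sqrt_coeff_Suc_nonpos[of n] by simp
qed

lemma summable_sqrt_one_minus:
  fixes x :: "'a::{real_normed_algebra_1, banach}"
  assumes "norm x \<le> 1"
  shows "summable (\<lambda>n. norm (sqrt_coeff n *\<^sub>R x ^ n))"
proof -
  have "summable (\<lambda>n. norm (sqrt_coeff (Suc n) *\<^sub>R x ^ Suc n))"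
    by (rule summable_comparison_test'[OF summable_minus_sqrt_coeff])
      (use norm_sqrt_one_minus_term_le[OF assms] in simp)
  then show ?thesis by (subst (asm) summable_Suc_iff)
qed

lemma sqrt_one_minus_square:
  fixes x :: "'a::{real_normed_algebra_1, banach}"
  assumes "norm x \<le> 1"
  shows "sqrt_one_minus x * sqrt_one_minus x = 1 - x"
proof -
  let ?f = "\<lambda>n. sqrt_coeff n *\<^sub>R x ^ n"
  let ?c = "\<lambda>n. if n = 0 then 1 else if n = 1 then - 1 else (0::real)"
  have "(\<Sum>k\<le>n. ?f k * ?f (n - k)) = ?c n *\<^sub>R x ^ n" for n
    unfolding sqrt_coeff_convolution[symmetric] scaleR_left.sum
    by (intro sum.cong refl) (simp flip: power_add)
  then have "(\<lambda>n. ?c n *\<^sub>R x ^ n) sums (sqrt_one_minus x * sqrt_one_minus x)"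
    using Cauchy_product_sums[OF summable_sqrt_one_minus summable_sqrt_one_minus, OF assms assms]
    by (simp only: sqrt_one_minus_def)
  moreover have "(\<lambda>n. ?c n *\<^sub>R x ^ n) sums (\<Sum>n\<in>{0, 1}. ?c n *\<^sub>R x ^ n)"
    by (rule sums_finite) auto
  ultimately show ?thesis by (simp add: sums_unique2)
qed

lemma norm_one_minus_sqrt_one_minus_le:
  fixes x :: "'a::{real_normed_algebra_1, banach}"
  assumes "norm x \<le> 1"
  shows "norm (1 - sqrt_one_minus x) \<le> 1"
proof -
  have "sqrt_one_minus x = 1 + (\<Sum>n. sqrt_coeff (Suc n) *\<^sub>R x ^ Suc n)"
    using suminf_split_head[OF summable_norm_cancel[OF summable_sqrt_one_minus[OF assms]]]
    by (simp add: sqrt_one_minus_def)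
  then have "norm (1 - sqrt_one_minus x) = norm (\<Sum>n. sqrt_coeff (Suc n) *\<^sub>R x ^ Suc n)"
    by simp
  also have "\<dots> \<le> (\<Sum>n. - sqrt_coeff (Suc n))"
    by (rule norm_suminf_le[OF norm_sqrt_one_minus_term_le[OF assms] summable_minus_sqrt_coeff])
  also have "\<dots> \<le> 1"
    by (rule suminf_le_const[OF summable_minus_sqrt_coeff sum_minus_sqrt_coeff_le_one])
  finally show ?thesis .
qed

lemma sqrt_one_minus_commute:
  fixes x c :: "'a::{real_normed_algebra_1, banach}"
  assumes "norm x \<le> 1" "c * x = x * c"
  shows "c * sqrt_one_minus x = sqrt_one_minus x * c"
proof -
  have summable: "summable (\<lambda>n. sqrt_coeff n *\<^sub>R x ^ n)"
    by (rule summable_norm_cancel[OF summable_sqrt_one_minus[OF assms(1)]])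
  have "c * x ^ n = x ^ n * c" for n
    using power_commuting_commutes[of x c n] assms(2) by simp
  then show ?thesis
    unfolding sqrt_one_minus_def suminf_mult[OF summable, symmetric] suminf_mult2[OF summable]
    by simp
qed

lemma adj_sqrt_one_minus:
  fixes x :: "'a::cstar_algebra"
  assumes "norm x \<le> 1"
  shows "adj (sqrt_one_minus x) = sqrt_one_minus (adj x)"
proof -
  have "summable (\<lambda>n. sqrt_coeff n *\<^sub>R x ^ n)"
    by (rule summable_norm_cancel[OF summable_sqrt_one_minus[OF assms]])
  from bounded_linear.suminf[OF bounded_linear_adj this] show ?thesis
    by (simp add: sqrt_one_minus_def adj_scaleR adj_power)
qed

lemma ex_sqrt_of_norm_le:
  fixes x :: "'a::cstar_algebra"
  assumes x: "selfadjoint x" and t: "norm (of_real t - x) \<le> t"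
  obtains q where "selfadjoint q" "norm (of_real (sqrt t) - q) \<le> sqrt t" "q * q = x"
    "\<And>c. c * x = x * c \<Longrightarrow> c * q = q * c"
proof (cases "t = 0")
  case True
  then show ?thesis using t that[of 0] by simp
next
  case False
  then have t_pos: "0 < t" using t norm_ge_zero[of "of_real t - x"] by linarith
  define y where "y = 1 - (1 / t) *\<^sub>R x"
  have x_eq: "x = t *\<^sub>R (1 - y)" using t_pos by (simp add: y_def)
  have "y = (1 / t) *\<^sub>R (of_real t - x)"
    using t_pos by (simp add: y_def of_real_def scaleR_diff_right)
  then have norm_y: "norm y \<le> 1" using t t_pos by simp
  have adj_y: "selfadjoint y" by (simp add: y_def adj_simps x)
  show ?thesis
  proof (rule that)
    show "selfadjoint (sqrt t *\<^sub>R sqrt_one_minus y)"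
      by (simp add: adj_scaleR adj_sqrt_one_minus[OF norm_y] adj_y)
    have "of_real (sqrt t) - sqrt t *\<^sub>R sqrt_one_minus y = sqrt t *\<^sub>R (1 - sqrt_one_minus y)"
      by (simp add: of_real_def scaleR_diff_right)
    then show "norm (of_real (sqrt t) - sqrt t *\<^sub>R sqrt_one_minus y) \<le> sqrt t"
      using t_pos norm_one_minus_sqrt_one_minus_le[OF norm_y] by (simp add: mult_left_le)
    show "(sqrt t *\<^sub>R sqrt_one_minus y) * (sqrt t *\<^sub>R sqrt_one_minus y) = x"
      using t_pos by (simp add: sqrt_one_minus_square[OF norm_y] x_eq)
    show "c * (sqrt t *\<^sub>R sqrt_one_minus y) = (sqrt t *\<^sub>R sqrt_one_minus y) * c"
      if "c * x = x * c" for c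
      using sqrt_one_minus_commute[OF norm_y, of c] that by (simp add: y_def algebra_simps)
  qed
qed

subsection \<open>Spectra of self-adjoint elements\<close>

lemma norm_of_real_minus_square_le:
  fixes y :: "'a::cstar_algebra"
  assumes y: "selfadjoint y"
  shows "norm (of_real ((norm y)\<^sup>2) - y * y) \<le> (norm y)\<^sup>2"
proof -
  define t where "t = (norm y)\<^sup>2"
  have "selfadjoint (of_real t - y * y)" "norm (of_real t - (of_real t - y * y)) \<le> t"
    using norm_selfadjoint_square[OF y] by (simp_all add: adj_simps y flip: t_def)
  then obtain p where p: "selfadjoint p" "p * p = of_real t - y * y"
    "\<And>c. c * (of_real t - y * y) = (of_real t - y * y) * c \<Longrightarrow> c * p = p * c"
    by (rule ex_sqrt_of_norm_le) blast
  have "y * p = p * y" by (rule p(3)) (simp add: of_real_def algebra_simps)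
  then have "(norm p)\<^sup>2 \<le> norm (p * p + y * y)"
    by (intro norm_square_le_norm_sum_squares) (simp_all add: p(1) y)
  also have "p * p + y * y = of_real t" by (simp add: p(2))
  also have "norm (of_real t :: 'a) = t" by (simp only: norm_of_real t_def abs_power2)
  finally have "norm (of_real t - y * y) \<le> t"
    using norm_selfadjoint_square[OF p(1)] by (simp add: p(2))
  then show ?thesis by (simp only: t_def)
qed

lemma invertible_selfadjoint_minus_nonreal:
  fixes x :: "'a::cstar_algebra"
  assumes x: "selfadjoint x" and z: "Im z \<noteq> 0"
  shows "invertible_el (x - scaleC z 1)"
proof -
  define y where "y = x - of_real (Re z)"
  define w where "w = \<i> * complex_of_real (Im z)"
  have w_square: "w * w = complex_of_real (- (Im z)\<^sup>2)"
    by (simp add: w_def power2_eq_square algebra_simps)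
  have y: "selfadjoint y" by (simp add: y_def adj_diff x)
  have "norm (of_real ((norm y)\<^sup>2) - y * y) < (norm y)\<^sup>2 + (Im z)\<^sup>2"
    using z by (intro order_le_less_trans[OF norm_of_real_minus_square_le[OF y]]) simp
  from invertible_el_of_real_minus[OF this] have "invertible_el (y * y - scaleC (w * w) 1)"
    unfolding w_square scaleC_of_real_one by (simp add: add.commute)
  then have "invertible_el (y - scaleC w 1)"
    using invertible_el_factor[of "y - scaleC w 1" "y + scaleC w 1"]
    by (simp only: mult_minus_add_scaleC mult_add_minus_scaleC)
  then show ?thesis
    by (simp add: scaleC_eq_of_real_add[of z] y_def w_def diff_diff_add)
qed

lemma positive_el_iff_invertible:
  fixes x :: "'a::cstar_algebra"
  shows "positive_el x \<longleftrightarrow> selfadjoint x \<and> (\<forall>e>0. invertible_el (x + of_real e))"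
proof (intro iffI conjI allI impI)
  assume x: "positive_el x"
  then show "selfadjoint x" by (simp add: positive_el_def)
  fix e :: real assume "0 < e"
  then have "complex_of_real (- e) \<notin> complex_of_real ` {0..}"
    by (auto simp del: of_real_minus simp: inj_image_mem_iff[OF inj_of_real])
  then have "complex_of_real (- e) \<notin> spectrum_el x" using x by (auto simp: positive_el_def)
  then show "invertible_el (x + of_real e)"
    by (simp add: spectrum_el_def del: of_real_minus) simp
next
  assume x: "selfadjoint x \<and> (\<forall>e>0. invertible_el (x + of_real e))"
  have "z \<in> complex_of_real ` {0..}" if z: "z \<in> spectrum_el x" for z
  proof -
    have "Im z = 0"
      using invertible_selfadjoint_minus_nonreal[of x z] x z by (auto simp: spectrum_el_def)
    then have real: "z = complex_of_real (Re z)" by (simp add: complex_eq_iff)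
    have "\<not> invertible_el (x + of_real (- Re z))"
      using z by (subst (asm) real) (simp add: spectrum_el_def)
    then have "\<not> 0 < - Re z" using x by blast
    then show ?thesis by (subst real) auto
  qed
  then show "positive_el x" using x by (auto simp: positive_el_def)
qed

lemma positive_el_selfadjoint: "positive_el x \<Longrightarrow> selfadjoint x"
  by (simp add: positive_el_def)

lemma positive_el_invertible_add: "positive_el x \<Longrightarrow> 0 < e \<Longrightarrow> invertible_el (x + of_real e)"
  by (simp add: positive_el_iff_invertible)

lemma positive_elI_norm:
  assumes x: "selfadjoint x" and t: "norm (of_real t - x) \<le> t"
  shows "positive_el x"
  unfolding positive_el_iff_invertible
proof (intro conjI allI impI x)
  fix e :: real assume "0 < e"
  then have "invertible_el (of_real (t + e) - (of_real t - x))"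
    by (intro invertible_el_of_real_minus) (use t in linarith)
  then show "invertible_el (x + of_real e)" by (simp add: algebra_simps)
qed

lemma positive_el_square: "selfadjoint x \<Longrightarrow> positive_el (x * x)"
  by (rule positive_elI_norm[OF _ norm_of_real_minus_square_le]) (simp_all add: adj_mult)

text \<open>For small \<open>e\<close>, \<open>b - e = b (1 - e b\<^bsup>-1\<^esup>)\<close> is a product of commuting squares.\<close>

lemma ex_sqrt_minus_of_real:
  fixes b :: "'a::cstar_algebra"
  assumes b: "selfadjoint b" and t_bound: "norm (of_real t - b) \<le> t" and inv: "invertible_el b"
  obtains e q where "0 < e" "e \<le> t" "selfadjoint q" "q * q = b - of_real e"
    "\<And>c. c * b = b * c \<Longrightarrow> c * q = q * c"
proof -
  define v where "v = inv_el b"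
  have inverse: "b * v = 1" "v * b = 1" by (simp_all add: v_def mult_inv_el inv_el_mult inv)
  have v: "selfadjoint v" using selfadjoint_inv_el[OF b inv] by (simp add: v_def)
  have "v \<noteq> 0" using inverse(1) by auto
  have "t \<noteq> 0" using t_bound inverse(1) by auto
  then have "0 < t" using t_bound norm_ge_zero[of "of_real t - b"] by linarith
  define e where "e = min t (1 / norm v)"
  have e: "0 < e" "e \<le> t" using \<open>0 < t\<close> \<open>v \<noteq> 0\<close> by (simp_all add: e_def)
  have "e * norm v \<le> 1 / norm v * norm v" by (intro mult_right_mono) (simp_all add: e_def)
  then have "norm (of_real 1 - (1 - e *\<^sub>R v)) \<le> 1" using e \<open>v \<noteq> 0\<close> by simp
  moreover have "selfadjoint (1 - e *\<^sub>R v)" by (simp add: adj_simps v)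
  ultimately obtain r where r: "selfadjoint r" "r * r = 1 - e *\<^sub>R v"
    "\<And>c. c * (1 - e *\<^sub>R v) = (1 - e *\<^sub>R v) * c \<Longrightarrow> c * r = r * c"
    by (metis ex_sqrt_of_norm_le)
  obtain p where p: "selfadjoint p" "p * p = b" "\<And>c. c * b = b * c \<Longrightarrow> c * p = p * c"
    using ex_sqrt_of_norm_le[OF b t_bound] by blast
  have r_commute: "c * r = r * c" if "c * b = b * c" for c
    using inv_el_commute[OF inv that] by (intro r(3)) (simp add: v_def algebra_simps)
  have p_commute_r: "p * r = r * p" by (rule r_commute) (simp add: mult.assoc flip: p(2))
  show ?thesis
  proof (rule that[OF e])
    show "selfadjoint (p * r)" by (simp add: adj_mult p(1) r(1) p_commute_r)
    have "(p * r) * (p * r) = (p * p) * (r * r)"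
      by (simp add: mult.assoc commute_left[OF p_commute_r[symmetric]])
    then show "(p * r) * (p * r) = b - of_real e"
      by (simp add: p(2) r(2) right_diff_distrib inverse of_real_def)
    show "c * (p * r) = (p * r) * c" if "c * b = b * c" for c
      by (simp add: mult.assoc commute_left[OF p(3)[OF that]] r_commute[OF that])
  qed
qed

text \<open>The norm of a self-adjoint element is attained on its spectrum.\<close>

lemma norm_minus_or_plus_not_invertible:
  fixes y :: "'a::cstar_algebra"
  assumes y: "selfadjoint y" and "y \<noteq> 0"
  shows "\<not> (invertible_el (of_real (norm y) - y) \<and> invertible_el (of_real (norm y) + y))"
proof
  define t where "t = (norm y)\<^sup>2"
  define b where "b = of_real t - y * y"
  assume "invertible_el (of_real (norm y) - y) \<and> invertible_el (of_real (norm y) + y)"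
  then have "invertible_el ((of_real (norm y) - y) * (of_real (norm y) + y))"
    by (blast intro: invertible_el_mult)
  also have "(of_real (norm y) - y) * (of_real (norm y) + y) = b"
    by (simp add: b_def t_def of_real_def algebra_simps power2_eq_square)
  finally have inv: "invertible_el b" .
  have "selfadjoint b" "norm (of_real t - b) \<le> t"
    by (simp_all add: b_def t_def adj_simps y norm_selfadjoint_square adj_power)
  then obtain e q where e: "0 < e" "e \<le> t" and q: "selfadjoint q" "q * q = b - of_real e"
    and q_commute: "\<And>c. c * b = b * c \<Longrightarrow> c * q = q * c"
    using inv by (rule ex_sqrt_minus_of_real) blast
  have "y * q = q * y" by (rule q_commute) (simp add: b_def of_real_def algebra_simps)
  then have "(norm y)\<^sup>2 \<le> norm (y * y + q * q)"
    by (intro norm_square_le_norm_sum_squares y q(1))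
  also have "y * y + q * q = of_real (t - e)" by (simp add: q(2) b_def)
  finally have "t \<le> \<bar>t - e\<bar>" by (simp only: norm_of_real t_def)
  then show False using e by linarith
qed

lemma norm_of_real_minus_positive_le:
  fixes x :: "'a::cstar_algebra"
  assumes x: "positive_el x" and t: "norm x \<le> t"
  shows "norm (of_real t - x) \<le> t"
proof (rule ccontr)
  define y where "y = of_real t - x"
  assume "\<not> norm (of_real t - x) \<le> t"
  then have less: "t < norm y" by (simp add: y_def)
  have t_nonneg: "0 \<le> t" using t norm_ge_zero[of x] by linarith
  have "invertible_el (x + of_real (norm y - t))"
    using less by (intro positive_el_invertible_add[OF x]) simp
  then have "invertible_el (of_real (norm y) - y)" by (simp add: y_def algebra_simps)
  moreover have "invertible_el (of_real (norm y + t) - x)"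
    using t t_nonneg less by (intro invertible_el_of_real_minus) linarith
  then have "invertible_el (of_real (norm y) + y)" by (simp add: y_def algebra_simps)
  moreover have "selfadjoint y" by (simp add: y_def adj_diff positive_el_selfadjoint[OF x])
  moreover have "y \<noteq> 0" using less t_nonneg by auto
  ultimately show False using norm_minus_or_plus_not_invertible by blast
qed

subsection \<open>The cone of positive elements\<close>

lemma positive_el_add:
  assumes x: "positive_el x" and y: "positive_el y"
  shows "positive_el (x + y)"
proof (rule positive_elI_norm)
  show "selfadjoint (x + y)" by (simp add: adj_add x y positive_el_selfadjoint)
  have "norm (of_real (norm x) - x + (of_real (norm y) - y)) \<le> norm x + norm y"
    by (intro norm_triangle_mono norm_of_real_minus_positive_le x y order_refl)
  then show "norm (of_real (norm x + norm y) - (x + y)) \<le> norm x + norm y"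
    by (simp add: algebra_simps)
qed

lemma positive_el_of_real_iff: "positive_el (of_real r :: 'a::cstar_algebra) \<longleftrightarrow> 0 \<le> r"
proof
  assume "positive_el (of_real r :: 'a)"
  then have "norm (of_real \<bar>r\<bar> - of_real r :: 'a) \<le> \<bar>r\<bar>"
    by (rule norm_of_real_minus_positive_le) simp
  then have "\<bar>\<bar>r\<bar> - r\<bar> \<le> \<bar>r\<bar>" by (metis norm_of_real of_real_diff)
  then show "0 \<le> r" by linarith
qed (rule positive_elI_norm[of _ r], simp_all)

lemma positive_el_of_real_minus: "selfadjoint x \<Longrightarrow> norm x \<le> t \<Longrightarrow> positive_el (of_real t - x)"
  by (rule positive_elI_norm[of _ t]) (simp_all add: adj_diff)

lemma positive_el_of_real_plus: "selfadjoint x \<Longrightarrow> norm x \<le> t \<Longrightarrow> positive_el (of_real t + x)"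
  using positive_el_of_real_minus[of "- x" t] by simp

lemma positive_el_sqrt:
  assumes "positive_el x"
  obtains q where "positive_el q" "q * q = x" "\<And>c. c * x = x * c \<Longrightarrow> c * q = q * c"
proof -
  obtain q where "selfadjoint q" "norm (of_real (sqrt (norm x)) - q) \<le> sqrt (norm x)"
    "q * q = x" "\<And>c. c * x = x * c \<Longrightarrow> c * q = q * c"
    using ex_sqrt_of_norm_le[OF positive_el_selfadjoint[OF assms]
        norm_of_real_minus_positive_le[OF assms order_refl]] by blast
  then show ?thesis using that positive_elI_norm[of q] by blast
qed

lemma positive_el_mult:
  assumes x: "positive_el x" and y: "positive_el y" and commute: "x * y = y * x"
  shows "positive_el (x * y)"
proof -
  obtain p where p: "positive_el p" "p * p = x" "\<And>c. c * x = x * c \<Longrightarrow> c * p = p * c"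
    using x by (rule positive_el_sqrt) blast
  obtain q where q: "positive_el q" "q * q = y" "\<And>c. c * y = y * c \<Longrightarrow> c * q = q * c"
    using y by (rule positive_el_sqrt) blast
  have "p * y = y * p" using p(3)[of y] commute by simp
  then have roots_commute: "p * q = q * p" by (rule q(3))
  have "positive_el ((p * q) * (p * q))"
    by (rule positive_el_square)
      (simp add: adj_mult positive_el_selfadjoint p(1) q(1) roots_commute)
  also have "(p * q) * (p * q) = x * y"
    by (simp add: mult.assoc commute_left[OF roots_commute[symmetric]] flip: p(2) q(2))
  finally show ?thesis .
qed

lemma positive_el_scaleR:
  assumes "positive_el x" "0 \<le> r"
  shows "positive_el (r *\<^sub>R x)"
  using positive_el_mult[of "of_real r" x] assms
  by (simp add: positive_el_of_real_iff) (simp add: of_real_def)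

lemma positive_el_inv_el:
  assumes x: "positive_el x" and inv: "invertible_el x"
  shows "positive_el (inv_el x)"
proof -
  have inv_x: "x * inv_el x = 1" "inv_el x * x = 1" by (simp_all add: mult_inv_el inv_el_mult inv)
  have "positive_el (inv_el x * inv_el x)"
    by (intro positive_el_square selfadjoint_inv_el positive_el_selfadjoint x inv)
  then have "positive_el (x * (inv_el x * inv_el x))"
    by (rule positive_el_mult[OF x]) (simp add: inv_x mult.assoc flip: mult.assoc[of x])
  then show ?thesis by (simp add: inv_x flip: mult.assoc)
qed

lemma selfadjoint_norm_le_iff:
  assumes x: "selfadjoint x"
  shows "norm x \<le> t \<longleftrightarrow> positive_el (of_real t - x) \<and> positive_el (of_real t + x)"
proof (intro iffI conjI)
  assume "positive_el (of_real t - x) \<and> positive_el (of_real t + x)"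
  then have minus: "positive_el (of_real t - x)" and plus: "positive_el (of_real t + x)" by auto
  have "of_real (t + t) = (of_real t - x) + (of_real t + x)" by (simp only: of_real_add) simp
  then have "positive_el (of_real (t + t) :: 'a)" by (simp only: positive_el_add minus plus)
  then have t: "0 \<le> t" unfolding positive_el_of_real_iff by simp
  have commute: "of_real t * x = x * of_real t" by (simp add: of_real_def)
  have factor: "(of_real t - x) * (of_real t + x) = of_real (t * t) - x * x"
    "(of_real t + x) * (of_real t - x) = of_real (t * t) - x * x"
    using commute by (simp_all add: algebra_simps)
  have "positive_el ((of_real t - x) * (of_real t + x))"
    by (rule positive_el_mult[OF minus plus]) (simp only: factor)
  then have "positive_el (of_real (t * t) - x * x)" by (simp only: factor)
  then obtain q where q: "positive_el q" "q * q = of_real (t * t) - x * x"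
    "\<And>c. c * (of_real (t * t) - x * x) = (of_real (t * t) - x * x) * c \<Longrightarrow> c * q = q * c"
    by (rule positive_el_sqrt) blast
  have "x * q = q * x" by (rule q(3)) (simp add: of_real_def algebra_simps)
  then have "(norm x)\<^sup>2 \<le> norm (x * x + q * q)"
    by (intro norm_square_le_norm_sum_squares x positive_el_selfadjoint q(1))
  also have "x * x + q * q = of_real (t\<^sup>2)" by (simp add: q(2) power2_eq_square)
  finally show "norm x \<le> t" using t by (simp only: norm_of_real abs_power2 power2_le_imp_le)
qed (blast intro: positive_el_of_real_minus[OF x] positive_el_of_real_plus[OF x])+

lemma positive_el_norm_le_iff:
  assumes x: "positive_el x"
  shows "norm x \<le> t \<longleftrightarrow> positive_el (of_real t - x)"
proof
  assume minus: "positive_el (of_real t - x)"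
  have "positive_el (of_real t - x + (x + x))" by (intro positive_el_add minus x)
  then show "norm x \<le> t"
    using minus by (simp add: selfadjoint_norm_le_iff positive_el_selfadjoint[OF x] algebra_simps)
qed (rule positive_el_of_real_minus[OF positive_el_selfadjoint[OF x]])

lemma positive_el_antisym:
  assumes "positive_el x" "positive_el (- x)"
  shows "x = 0"
  using positive_el_norm_le_iff[OF assms(1), of 0] assms(2) by simp

lemma norm_positive_add_of_real:
  assumes x: "positive_el x" and r: "0 \<le> r"
  shows "norm (x + of_real r) = norm x + r"
proof (rule antisym)
  show "norm (x + of_real r) \<le> norm x + r"
    using norm_triangle_ineq[of x "of_real r"] r by simp
  have "positive_el (of_real (norm (x + of_real r)) - (x + of_real r))"
    by (intro positive_el_of_real_minus) (simp_all add: adj_add positive_el_selfadjoint[OF x])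
  then show "norm x + r \<le> norm (x + of_real r)"
    using positive_el_norm_le_iff[OF x, of "norm (x + of_real r) - r"] by (simp add: algebra_simps)
qed

lemma positive_el_minus_square:
  assumes "skewadjoint k"
  shows "positive_el (- (k * k))"
proof -
  have "positive_el (scaleC \<i> k * scaleC \<i> k)"
    by (rule positive_el_square) (simp add: adj_scaleC assms scaleC_minus_left scaleC_minus_right)
  then show ?thesis by (simp add: scaleC_mult_scaleC scaleC_minus_left scaleC_one)
qed

lemma norm_mult_norm_add_inverse_le:
  assumes selfadjoint: "selfadjoint x" "selfadjoint y" and inverse: "x * y = 1" "y * x = 1"
    and norm_eq: "norm x = norm y" and positive: "positive_el (x + y)"
  shows "norm x * norm (x + y) \<le> (norm x)\<^sup>2 + 1"
proof -
  define r where "r = norm x"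
  have "positive_el ((of_real r - x) * (of_real r - y))"
  proof (rule positive_el_mult)
    show "positive_el (of_real r - x)" "positive_el (of_real r - y)"
      by (simp_all add: positive_el_of_real_minus selfadjoint norm_eq r_def)
    show "(of_real r - x) * (of_real r - y) = (of_real r - y) * (of_real r - x)"
      by (simp add: of_real_def algebra_simps inverse)
  qed
  also have "(of_real r - x) * (of_real r - y) = of_real (r * r + 1) - r *\<^sub>R (x + y)"
    by (simp add: of_real_def algebra_simps inverse)
  finally have "norm (r *\<^sub>R (x + y)) \<le> r * r + 1"
    using positive_el_norm_le_iff[OF positive_el_scaleR[OF positive, of r]] by (simp add: r_def)
  then show ?thesis by (simp add: r_def power2_eq_square)
qed

subsection \<open>Square roots and Moore--Penrose inverses\<close>

lemma positive_el_commuting_square_inject: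
  assumes y: "positive_el y" and z: "positive_el z" and yz_commute: "y * z = z * y"
    and squares: "y * y = z * z"
  shows "y = z"
proof -
  define d where "d = y - z"
  have d: "selfadjoint d" by (simp add: d_def adj_diff positive_el_selfadjoint y z)
  have commute: "y * d = d * y" "z * d = d * z" by (simp_all add: d_def algebra_simps yz_commute)
  have pos: "positive_el (y * (d * d))" "positive_el (z * (d * d))"
    by (intro positive_el_mult positive_el_square y z d;
        simp add: mult.assoc commute commute_left[OF commute(1)] commute_left[OF commute(2)])+
  have "(y + z) * d = 0" by (simp add: d_def algebra_simps yz_commute squares)
  then have "(y + z) * (d * d) = 0" by (simp flip: mult.assoc)
  then have z_eq: "z * (d * d) = - (y * (d * d))"
    by (simp add: distrib_right eq_neg_iff_add_eq_0 add.commute)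
  then have "y * (d * d) = 0" using positive_el_antisym[OF pos(1)] pos(2) by simp
  then have "d * (d * d) = 0" using z_eq by (simp add: d_def left_diff_distrib)
  then have "(d * d) * (d * d) = 0" by (simp add: mult.assoc)
  then have "(norm (d * d))\<^sup>2 = 0"
    using norm_selfadjoint_square[of "d * d"] by (simp add: adj_mult d)
  then have "d = 0" using norm_selfadjoint_square[OF d] by simp
  then show ?thesis by (simp add: d_def)
qed

lemma sqrt_el_eqI:
  assumes y: "positive_el y" and x: "y * y = x"
  shows "sqrt_el x = y"
  unfolding sqrt_el_def
proof (rule the_equality)
  have "positive_el x" using positive_el_square[OF positive_el_selfadjoint[OF y]] x by simp
  then obtain q where q: "positive_el q" "q * q = x" "\<And>c. c * x = x * c \<Longrightarrow> c * q = q * c"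
    by (rule positive_el_sqrt) blast
  have eq_q: "z = q" if z: "positive_el z" "z * z = x" for z
  proof (rule positive_el_commuting_square_inject[OF z(1) q(1)])
    show "z * q = q * z" by (rule q(3)) (simp add: mult.assoc flip: z(2))
  qed (simp only: z(2) q(2))
  show "z = y" if "positive_el z \<and> z * z = x" for z
    using that eq_q[of z] eq_q[OF y x] by simp
qed (simp add: y x)

lemma
  assumes "positive_el x"
  shows positive_el_sqrt_el: "positive_el (sqrt_el x)"
    and sqrt_el_square: "sqrt_el x * sqrt_el x = x"
proof -
  obtain q where "positive_el q" "q * q = x" using assms by (rule positive_el_sqrt)
  then show "positive_el (sqrt_el x)" "sqrt_el x * sqrt_el x = x"
    using sqrt_el_eqI[of q x] by simp_all
qed

lemma sqrt_el_commute:
  assumes "positive_el x" "c * x = x * c"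
  shows "c * sqrt_el x = sqrt_el x * c"
proof -
  obtain q where q: "positive_el q" "q * q = x" "\<And>c. c * x = x * c \<Longrightarrow> c * q = q * c"
    using assms(1) by (rule positive_el_sqrt) blast
  then show ?thesis using sqrt_el_eqI[OF q(1,2)] q(3)[OF assms(2)] by metis
qed

lemma positive_el_minus_of_real:
  assumes x: "positive_el x" and r: "0 < r" and square: "positive_el (x * x - of_real (r * r))"
  shows "positive_el (x - of_real r)"
proof -
  have pos: "positive_el (x + of_real r)"
    using r by (intro positive_el_add x) (simp add: positive_el_of_real_iff)
  have inv: "invertible_el (x + of_real r)" by (rule positive_el_invertible_add[OF x r])
  have factor: "x * x - of_real (r * r) = (x - of_real r) * (x + of_real r)"
    "x * x - of_real (r * r) = (x + of_real r) * (x - of_real r)"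
    by (simp_all add: of_real_def algebra_simps)
  have "positive_el ((x * x - of_real (r * r)) * inv_el (x + of_real r))"
  proof (intro positive_el_mult square positive_el_inv_el pos inv inv_el_commute)
    show "(x * x - of_real (r * r)) * (x + of_real r) = (x + of_real r) * (x * x - of_real (r * r))"
      by (subst factor(2), subst factor(1)) (simp only: mult.assoc)
  qed
  also have "(x * x - of_real (r * r)) * inv_el (x + of_real r) = x - of_real r"
    unfolding factor(1) by (simp only: mult.assoc mult_inv_el[OF inv] mult_1_right)
  finally show ?thesis .
qed

lemma mp_inv_eqI:
  fixes T X :: "'a::cstar_algebra"
  assumes X: "T * X * T = T" "X * T * X = X" "adj (T * X) = T * X" "adj (X * T) = X * T"
  shows "mp_inv T = X"
  unfolding mp_inv_def
proof (rule the_equality)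
  fix Y assume Y: "T * Y * T = T \<and> Y * T * Y = Y \<and> adj (T * Y) = T * Y \<and> adj (Y * T) = Y * T"
  have "T * Y = adj (T * X * (T * Y))" using X(1) Y by (metis mult.assoc)
  also have "\<dots> = T * Y * (T * X)" using X(3) Y by (metis adj_mult)
  also have "\<dots> = T * X" using Y by (metis mult.assoc)
  finally have range_eq: "T * Y = T * X" .
  have "Y * T = adj (Y * T * (X * T))" using X(1) Y by (metis mult.assoc)
  also have "\<dots> = X * T * (Y * T)" using X(4) Y by (metis adj_mult)
  also have "\<dots> = X * T" using Y by (metis mult.assoc)
  finally have "Y * T = X * T" .
  then show "Y = X" using range_eq X(2) Y by (metis mult.assoc)
qed (use X in simp)

subsection \<open>Projections and off-diagonal elements\<close>

definition projection_el :: "'a::cstar_algebra \<Rightarrow> bool" where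
  "projection_el p \<longleftrightarrow> selfadjoint p \<and> p * p = p"

abbreviation off_diagonal :: "'a::cstar_algebra \<Rightarrow> 'a \<Rightarrow> bool" where
  "off_diagonal p y \<equiv> p * y = y * (1 - p)"

lemma projection_elD:
  assumes "projection_el p"
  shows "selfadjoint p" "p * p = p" "p * (p * x) = p * x"
  using assms by (simp_all add: projection_el_def flip: mult.assoc)

lemma projection_el_complement: "projection_el p \<Longrightarrow> projection_el (1 - p)"
  by (simp add: projection_el_def adj_diff algebra_simps)

lemma positive_el_projection: "projection_el p \<Longrightarrow> positive_el p"
  using positive_el_square[of p] by (simp add: projection_el_def)

lemma norm_projection_le_one:
  assumes "projection_el p"
  shows "norm p \<le> 1"
proof -
  have "norm p * norm p = norm p"
    using norm_selfadjoint_square[of p] projection_elD[OF assms] by (simp add: power2_eq_square)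
  then show ?thesis by (metis mult_cancel_right1 norm_eq_zero order_refl zero_le_one)
qed

lemma norm_projection_mult_le: "projection_el p \<Longrightarrow> norm (p * x) \<le> norm x"
  by (meson norm_mult_ineq norm_projection_le_one order_trans mult_left_le_one_le norm_ge_zero)

lemma positive_el_corner:
  assumes p: "projection_el p" and c: "selfadjoint c" and commute: "p * c = c * p"
    and M: "norm (p * c) \<le> M"
  shows "positive_el (p * (of_real M - c))"
proof -
  have "positive_el (of_real M - p * c)"
    using M
    by (intro positive_el_of_real_minus) (simp_all add: adj_mult c commute projection_elD[OF p])
  then have "positive_el (p * (of_real M - p * c))"
    by (intro positive_el_mult[OF positive_el_projection[OF p]])
      (simp_all add: left_diff_distrib right_diff_distrib mult.assoc of_real_def commute
        commute_left[OF commute] projection_elD[OF p])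
  also have "p * (of_real M - p * c) = p * (of_real M - c)"
    by (simp add: right_diff_distrib projection_elD[OF p])
  finally show ?thesis .
qed

lemma norm_le_max_corners:
  assumes p: "projection_el p" and c: "selfadjoint c" and commute: "p * c = c * p"
  shows "norm c \<le> max (norm (p * c)) (norm ((1 - p) * c))" (is "_ \<le> ?M")
proof -
  have positive: "positive_el (of_real ?M - x)"
    if x: "selfadjoint x" "p * x = x * p"
      and norm_x: "norm (p * x) \<le> ?M" "norm ((1 - p) * x) \<le> ?M"
    for x
  proof -
    have "(1 - p) * x = x * (1 - p)" by (simp add: left_diff_distrib right_diff_distrib x(2))
    then have "positive_el (p * (of_real ?M - x) + (1 - p) * (of_real ?M - x))"
      by (intro positive_el_add positive_el_corner projection_el_complement p x norm_x)
    then show ?thesis by (simp flip: distrib_right)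
  qed
  have "positive_el (of_real ?M - c)" "positive_el (of_real ?M - - c)"
    by (intro positive; simp add: c commute)+
  then show ?thesis by (simp add: selfadjoint_norm_le_iff[OF c])
qed

lemma projection_off_diagonal_corner:
  assumes p: "projection_el p" and off_diag: "off_diagonal p y"
  shows "p * (y * adj y) = y * adj y * p" "p * (y * adj y) = (p * y) * adj (p * y)"
proof -
  have adj_off_diag: "adj y * p = (1 - p) * adj y"
    using arg_cong[OF off_diag, of adj] by (simp add: adj_mult adj_diff projection_elD[OF p])
  have "p * (y * adj y) = y * ((1 - p) * adj y)" by (simp add: off_diag flip: mult.assoc)
  then show commute: "p * (y * adj y) = y * adj y * p" by (simp add: mult.assoc flip: adj_off_diag)
  have "(p * y) * adj (p * y) = p * (y * adj y * p)"
    by (simp add: adj_mult projection_elD[OF p] mult.assoc)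
  then show "p * (y * adj y) = (p * y) * adj (p * y)"
    by (simp add: projection_elD[OF p] flip: commute)
qed

lemma norm_projection_mult_off_diagonal:
  assumes p: "projection_el p" and off_diag: "off_diagonal p y" and normal: "y * adj y = adj y * y"
  shows "norm (p * y) = norm y"
proof (rule antisym)
  have compl: "projection_el (1 - p)" by (rule projection_el_complement[OF p])
  have off_diag_compl: "(1 - p) * y = y * p"
    by (simp add: left_diff_distrib right_diff_distrib off_diag)
  note corner = projection_off_diagonal_corner[OF p off_diag]
  have "(1 - p) * (y * adj y) = ((1 - p) * y) * adj ((1 - p) * y)"
    by (rule projection_off_diagonal_corner[OF compl]) (simp add: off_diag_compl)
  then have "norm ((1 - p) * (y * adj y)) = (norm (y * p))\<^sup>2"
    by (simp only: norm_mult_adj off_diag_compl)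
  also have "\<dots> = norm (adj (y * p) * (y * p))" by (simp only: cstar_identity)
  also have "adj (y * p) * (y * p) = p * (y * adj y * p)"
    by (simp only: adj_mult projection_elD[OF p] normal mult.assoc)
  also have "\<dots> = (p * y) * adj (p * y)"
    unfolding corner(1)[symmetric] projection_elD(3)[OF p] by (rule corner(2))
  finally have norm_corner_compl: "norm ((1 - p) * (y * adj y)) = (norm (p * y))\<^sup>2"
    by (simp only: norm_mult_adj)
  have "norm (y * adj y) \<le> max (norm (p * (y * adj y))) (norm ((1 - p) * (y * adj y)))"
    by (intro norm_le_max_corners p corner) (simp add: adj_simps)
  then have "(norm y)\<^sup>2 \<le> (norm (p * y))\<^sup>2"
    by (simp only: norm_corner_compl corner(2) norm_mult_adj max.idem)
  then show "norm y \<le> norm (p * y)" by simp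
qed (rule norm_projection_mult_le[OF p])

lemma norm_one_minus_skew_square:
  assumes k: "skewadjoint k"
  shows "norm (1 - k * k) = 1 + (norm k)\<^sup>2"
proof -
  have "norm (- (k * k)) = (norm k)\<^sup>2" using norm_mult_adj[of k] by (simp add: k)
  then show ?thesis
    using norm_positive_add_of_real[OF positive_el_minus_square[OF k], of 1]
    by (simp add: add.commute)
qed

lemma norm_projection_mult_one_minus_skew_square:
  assumes p: "projection_el p" and off_diag: "off_diagonal p k" and k: "skewadjoint k" and "k \<noteq> 0"
  shows "norm (p * (1 - k * k)) = 1 + (norm k)\<^sup>2"
proof (rule antisym)
  show "norm (p * (1 - k * k)) \<le> 1 + (norm k)\<^sup>2"
    using norm_projection_mult_le[OF p, of "1 - k * k"]
    by (simp add: norm_one_minus_skew_square[OF k])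
  note corner = projection_off_diagonal_corner[OF p off_diag]
  define d where "d = p * (k * adj k)"
  have d_commute: "p * - (k * k) = - (k * k) * p" using corner(1) by (simp add: k)
  have "positive_el (p * - (k * k))"
    by (intro positive_el_mult positive_el_projection p positive_el_minus_square k d_commute)
  then have d_pos: "positive_el d" by (simp add: d_def k)
  have "norm d = (norm (p * k))\<^sup>2" unfolding d_def corner(2) by (rule norm_mult_adj)
  also have "\<dots> = (norm k)\<^sup>2" using norm_projection_mult_off_diagonal[OF p off_diag] by (simp add: k)
  finally have "1 + (norm k)\<^sup>2 = norm (d + 1)"
    using norm_positive_add_of_real[OF d_pos, of 1] by simp
  also have "\<dots> \<le> max (norm (p * (d + 1))) (norm ((1 - p) * (d + 1)))"
  proof (rule norm_le_max_corners[OF p])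
    show "selfadjoint (d + 1)" by (simp add: adj_add positive_el_selfadjoint[OF d_pos])
    have "d * p = d" unfolding d_def corner(1) by (simp add: mult.assoc projection_elD[OF p])
    moreover have "p * d = d" by (simp add: d_def projection_elD[OF p])
    ultimately show "p * (d + 1) = (d + 1) * p" by (simp add: distrib_left distrib_right)
  qed
  also have "p * (d + 1) = p * (1 - k * k)"
    by (simp add: d_def distrib_left right_diff_distrib projection_elD[OF p] k)
  also have "(1 - p) * (d + 1) = 1 - p"
    by (simp add: d_def algebra_simps projection_elD[OF p])
  finally show "1 + (norm k)\<^sup>2 \<le> norm (p * (1 - k * k))"
    using norm_projection_le_one[OF projection_el_complement[OF p]] \<open>k \<noteq> 0\<close>
    by (auto simp: le_max_iff_disj dest: order_trans)
qed

subsection \<open>The matched projection of an idempotent\<close>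

locale idempotent_el =
  fixes Q :: "'a::cstar_algebra"
  assumes idem: "Q * Q = Q"
begin

abbreviation R :: 'a where "R \<equiv> adj Q"
definition h :: 'a where "h = Q + R - 1"
definition k :: 'a where "k = Q - R"
definition a :: 'a where "a = abs_el h"
definition a_inv :: 'a where "a_inv = inv_el a"
definition a_plus_one_inv :: 'a where "a_plus_one_inv = inv_el (a + 1)"
definition u :: 'a where "u = h * a_inv"
definition P :: 'a where "P = Q * R * a_inv * a_inv"

lemma idem_adj: "R * R = R"
  using arg_cong[OF idem, of adj] by (simp add: adj_mult)

lemma idem_simps: "Q * Q = Q" "R * R = R" "Q * (Q * x) = Q * x" "R * (R * x) = R * x"
  by (simp_all add: idem idem_adj flip: mult.assoc)

lemma selfadjoint_h: "selfadjoint h" by (simp add: h_def adj_simps)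
lemma skewadjoint_k: "skewadjoint k" by (simp add: k_def adj_simps)

lemma k_square: "k * k = Q + R - Q * R - R * Q"
  by (simp add: k_def algebra_simps idem_simps)

lemma h_square: "h * h = 1 - k * k"
  unfolding k_square by (simp add: h_def algebra_simps idem_simps)

lemma h_anticommute_k: "h * k = - (k * h)"
  by (simp add: h_def k_def algebra_simps idem_simps)

lemma a_eq_sqrt: "a = sqrt_el (h * h)" by (simp add: a_def abs_el_def selfadjoint_h)

lemma positive_a: "positive_el a"
  unfolding a_eq_sqrt by (intro positive_el_sqrt_el positive_el_square selfadjoint_h)

lemma selfadjoint_a: "selfadjoint a" by (rule positive_el_selfadjoint[OF positive_a])

lemma a_square_eq_h_square: "a * a = h * h"
  unfolding a_eq_sqrt by (intro sqrt_el_square positive_el_square selfadjoint_h)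

lemma a_square: "a * a = 1 - k * k"
  by (simp only: a_square_eq_h_square h_square)

lemma a_square_expand: "a * a = Q * R + R * Q - Q - R + 1"
  unfolding a_square k_square by simp

lemma invertible_a: "invertible_el a"
proof -
  have "invertible_el (a * a)"
    using positive_el_invertible_add[OF positive_el_minus_square[OF skewadjoint_k], of 1]
    by (simp add: a_square)
  then show ?thesis by (rule invertible_el_factor[OF refl])
qed

lemma invertible_a_plus_one: "invertible_el (a + 1)"
  using positive_el_invertible_add[OF positive_a, of 1] by simp

lemma a_commute: "c * (a * a) = a * a * c \<Longrightarrow> a * c = c * a"
  using sqrt_el_commute[OF positive_el_square[OF selfadjoint_h], of c]
  by (simp add: a_square_eq_h_square flip: a_eq_sqrt)

lemma a_inv_commute: "a * c = c * a \<Longrightarrow> a_inv * c = c * a_inv"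
  using inv_el_commute[OF invertible_a, of c] by (simp add: a_inv_def)

lemma a_plus_one_inv_commute: "a * c = c * a \<Longrightarrow> a_plus_one_inv * c = c * a_plus_one_inv"
  using inv_el_commute[OF invertible_a_plus_one, of c] unfolding a_plus_one_inv_def[symmetric]
  by (simp add: algebra_simps)

lemma Q_a_square: "Q * (a * a) = Q * (R * Q)" "a * a * Q = Q * (R * Q)"
  unfolding a_square_expand by (simp_all add: algebra_simps idem_simps)

lemma a_commute_Q: "a * Q = Q * a"
  by (rule a_commute) (simp only: Q_a_square)

lemma a_commute_R: "a * R = R * a"
  using arg_cong[OF a_commute_Q, of adj] by (simp add: adj_mult selfadjoint_a)

lemma a_inv_simps:
  "a * a_inv = 1" "a_inv * a = 1" "a * (a_inv * x) = x" "a_inv * (a * x) = x"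
  by (simp_all add: a_inv_def mult_inv_el inv_el_mult invertible_a flip: mult.assoc)

lemma a_plus_one_inv_simps:
  "a * a_plus_one_inv = 1 - a_plus_one_inv" "a_plus_one_inv * a = 1 - a_plus_one_inv"
  "a_plus_one_inv * a_inv = a_inv - a_plus_one_inv"
  "a_inv * a_plus_one_inv = a_inv - a_plus_one_inv"
proof -
  show left: "a * a_plus_one_inv = 1 - a_plus_one_inv"
    and right: "a_plus_one_inv * a = 1 - a_plus_one_inv"
    using mult_inv_el[OF invertible_a_plus_one] inv_el_mult[OF invertible_a_plus_one]
    unfolding a_plus_one_inv_def[symmetric] by (simp_all add: algebra_simps)
  have "a_inv * (a * a_plus_one_inv) = a_inv - a_inv * a_plus_one_inv"
    unfolding left by (simp add: right_diff_distrib)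
  then show mult: "a_inv * a_plus_one_inv = a_inv - a_plus_one_inv"
    by (simp add: a_inv_simps algebra_simps)
  show "a_plus_one_inv * a_inv = a_inv - a_plus_one_inv"
    using a_inv_commute[of a_plus_one_inv] mult left right by simp
qed

lemmas Q_R_simps = idem_simps a_inv_simps
  a_commute_Q commute_left[OF a_commute_Q] a_commute_R commute_left[OF a_commute_R]
  a_inv_commute[OF a_commute_Q] commute_left[OF a_inv_commute[OF a_commute_Q]]
  a_inv_commute[OF a_commute_R] commute_left[OF a_inv_commute[OF a_commute_R]]

lemma selfadjoint_a_inv: "selfadjoint a_inv"
  unfolding a_inv_def by (rule selfadjoint_inv_el[OF selfadjoint_a invertible_a])

lemma selfadjoint_P: "selfadjoint P"
  by (simp add: P_def adj_simps selfadjoint_a_inv mult.assoc Q_R_simps)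

lemma Q_mult_P: "Q * P = P" by (simp add: P_def mult.assoc Q_R_simps)

lemma P_mult_Q: "P * Q = Q"
proof -
  have "P * Q = (Q * (R * Q)) * (a_inv * a_inv)" by (simp add: P_def mult.assoc Q_R_simps)
  also have "\<dots> = Q" by (simp add: mult.assoc a_inv_simps flip: Q_a_square(1))
  finally show ?thesis .
qed

lemma P_mult_R: "P * R = P"
  using arg_cong[OF Q_mult_P, of adj] by (simp add: adj_mult selfadjoint_P)

lemma R_mult_P: "R * P = R"
  using arg_cong[OF P_mult_Q, of adj] by (simp add: adj_mult selfadjoint_P)

lemma P_mult_P: "P * P = P"
  by (subst (2) P_def) (simp add: P_mult_Q flip: mult.assoc, simp add: P_def)

lemma projection_P: "projection_el P"
  by (simp add: projection_el_def selfadjoint_P P_mult_P)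

lemma a_commute_P: "a * P = P * a" by (simp add: P_def mult.assoc Q_R_simps)

lemma P_left_simps: "Q * (P * x) = P * x" "P * (Q * x) = Q * x" "P * (R * x) = P * x"
  "R * (P * x) = R * x" "P * (P * x) = P * x"
  by (simp_all add: Q_mult_P P_mult_Q P_mult_R R_mult_P P_mult_P flip: mult.assoc)

lemmas P_simps = Q_mult_P P_mult_Q P_mult_R R_mult_P P_mult_P P_left_simps Q_R_simps
  a_commute_P commute_left[OF a_commute_P]
  a_inv_commute[OF a_commute_P] commute_left[OF a_inv_commute[OF a_commute_P]]
  a_plus_one_inv_commute[OF a_commute_P] commute_left[OF a_plus_one_inv_commute[OF a_commute_P]]

lemma P_mult_a_square: "P * (a * a) = Q * R"
  by (simp add: P_def mult.assoc Q_R_simps)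

lemma abs_el_R: "abs_el R = P * a"
  unfolding abs_el_def adj_adj
proof (rule sqrt_el_eqI)
  show "positive_el (P * a)"
    by (intro positive_el_mult positive_el_projection projection_P positive_a)
      (simp add: a_commute_P)
  show "(P * a) * (P * a) = Q * R" by (simp add: mult.assoc P_simps P_mult_a_square)
qed

lemma mp_inv_abs_el_R: "mp_inv (abs_el R) = P * a_inv"
  unfolding abs_el_R by (rule mp_inv_eqI) (simp_all add: mult.assoc P_simps selfadjoint_P)

lemma inv_el_abs_el_R_add_one: "inv_el (abs_el R + 1) = P * a_plus_one_inv + (1 - P)"
  unfolding abs_el_R by (rule inv_el_eqI) (simp_all add: algebra_simps P_simps a_plus_one_inv_simps)

lemma abs_el_R_add_R_mult_add_Q: "(abs_el R + R) * (abs_el R + Q) = (h + a) * (a + 1)"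
proof -
  have "(abs_el R + R) * (abs_el R + Q) = Q * R + Q * a + R * a + R * Q"
    by (simp add: abs_el_R algebra_simps P_simps P_mult_a_square)
  also have "\<dots> = (a * a + h) + (h + 1) * a"
    unfolding a_square_expand by (simp add: h_def algebra_simps)
  finally show ?thesis by (simp add: algebra_simps)
qed

lemma matched_proj_eq: "matched_proj Q = (1/2) *\<^sub>R (1 + u)"
proof -
  have "mp_inv (abs_el R) * inv_el (abs_el R + 1) * (abs_el R + Q)
      = (abs_el R + Q) * (a_plus_one_inv * a_inv)"
    unfolding mp_inv_abs_el_R inv_el_abs_el_R_add_one unfolding abs_el_R
    by (simp add: algebra_simps P_simps a_plus_one_inv_simps a_plus_one_inv_commute[OF a_commute_Q])
  then have "(abs_el R + R) * mp_inv (abs_el R) * inv_el (abs_el R + 1) * (abs_el R + Q)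
      = (h + a) * ((a + 1) * a_plus_one_inv) * a_inv"
    unfolding mult.assoc by (simp only: abs_el_R_add_R_mult_add_Q flip: mult.assoc)
  also have "\<dots> = (h + a) * a_inv"
    by (simp only: a_plus_one_inv_def mult_inv_el[OF invertible_a_plus_one] mult_1_right)
  also have "\<dots> = 1 + u" by (simp add: u_def distrib_right a_inv_simps)
  finally show ?thesis by (simp add: matched_proj_def adj_adj)
qed

lemma idempotent_el_adj: "idempotent_el R"
  by unfold_locales (rule idem_adj)

lemma idempotent_el_one_minus: "idempotent_el (1 - Q)"
  by unfold_locales (simp add: algebra_simps idem)

lemma a_adj: "idempotent_el.a R = a" and u_adj: "idempotent_el.u R = u"
proof -
  interpret adj: idempotent_el R by (rule idempotent_el_adj)
  have adj_h: "adj.h = h" by (simp add: adj.h_def h_def adj_adj)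
  then show adj_a: "adj.a = a" by (simp add: adj.a_def a_def)
  show "adj.u = u" by (simp add: adj.u_def u_def adj.a_inv_def a_inv_def adj_h adj_a)
qed

lemma matched_proj_adj: "matched_proj R = matched_proj Q"
  by (simp add: matched_proj_eq idempotent_el.matched_proj_eq[OF idempotent_el_adj] u_adj)

lemma a_one_minus: "idempotent_el.a (1 - Q) = a" and u_one_minus: "idempotent_el.u (1 - Q) = - u"
proof -
  interpret co: idempotent_el "1 - Q" by (rule idempotent_el_one_minus)
  have co_h: "co.h = - h" by (simp add: co.h_def h_def adj_diff)
  then show co_a: "co.a = a" by (simp add: co.a_eq_sqrt a_eq_sqrt)
  show "co.u = - u" by (simp add: co.u_def u_def co.a_inv_def a_inv_def co_h co_a)
qed

lemma matched_proj_one_minus: "matched_proj (1 - Q) = 1 - matched_proj Q"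
proof -
  have "1 - (1/2) *\<^sub>R (1 + u) = (1/2) *\<^sub>R (1 - u)"
    by (simp add: algebra_simps flip: scaleR_add_left)
  then show ?thesis
    by (simp add: matched_proj_eq idempotent_el.matched_proj_eq[OF idempotent_el_one_minus]
        u_one_minus)
qed

subsection \<open>Norms of the differences\<close>

lemma a_commute_h: "a * h = h * a" by (simp add: h_def algebra_simps a_commute_Q a_commute_R)
lemma a_commute_k: "a * k = k * a" by (simp add: k_def algebra_simps a_commute_Q a_commute_R)

lemma u_mult_a: "u * a = h" by (simp add: u_def mult.assoc a_inv_simps)

lemma a_commute_u: "a * u = u * a"
  by (simp add: u_def mult.assoc commute_left[OF a_commute_h] a_inv_simps)

lemma selfadjoint_u: "selfadjoint u"
  by (simp add: u_def adj_mult selfadjoint_h selfadjoint_a_inv a_inv_commute[OF a_commute_h])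

lemma u_square: "u * u = 1"
proof -
  have "u * u = (h * h) * (a_inv * a_inv)"
    by (simp add: u_def mult.assoc commute_left[OF a_inv_commute[OF a_commute_h]])
  also have "\<dots> = 1" by (simp add: mult.assoc a_inv_simps flip: a_square_eq_h_square)
  finally show ?thesis .
qed

lemma u_anticommute_k: "u * k = - (k * u)"
proof -
  have "u * k = (h * k) * a_inv"
    by (simp add: u_def mult.assoc a_inv_commute[OF a_commute_k])
  then show ?thesis by (simp add: u_def h_anticommute_k mult.assoc)
qed

lemma u_left_simps: "u * (u * x) = x" "u * (k * x) = - (k * (u * x))"
  by (simp_all add: u_square u_anticommute_k flip: mult.assoc)

lemmas u_simps = u_square u_anticommute_k u_left_simps a_commute_u commute_left[OF a_commute_u]
  a_commute_k commute_left[OF a_commute_k]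

lemma projection_matched_proj: "projection_el (matched_proj Q)"
proof -
  have "(1 + u) * (1 + u) = 2 *\<^sub>R (1 + u)" by (simp add: algebra_simps u_square scaleR_2)
  then show ?thesis
    by (simp add: projection_el_def matched_proj_eq adj_simps selfadjoint_u)
qed

lemma norm_a_square: "(norm a)\<^sup>2 = 1 + (norm k)\<^sup>2"
  using norm_one_minus_skew_square[OF skewadjoint_k] norm_selfadjoint_square[OF selfadjoint_a]
  by (simp add: a_square)

lemma norm_k: "norm k = sqrt ((norm a)\<^sup>2 - 1)"
  by (simp add: norm_a_square)

lemma norm_a_minus_one: "norm (a - 1) = norm a - 1"
proof -
  have "positive_el (a - 1)"
    using positive_el_minus_of_real[OF positive_a, of 1]
    by (simp add: a_square positive_el_minus_square skewadjoint_k)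
  from norm_positive_add_of_real[OF this, of 1] show ?thesis by simp
qed

lemma matched_proj_minus: "matched_proj Q - Q = (1/2) *\<^sub>R (u - u * a - k)"
proof -
  have "2 *\<^sub>R (matched_proj Q - Q) = u - u * a - k"
    unfolding u_mult_a by (simp add: matched_proj_eq h_def k_def scaleR_diff_right scaleR_2)
  then show ?thesis by (metis scaleR_half_double scaleR_2 scaleR_add_right)
qed

lemma norm_matched_proj_minus_square:
  "norm ((matched_proj Q - Q) * (matched_proj Q - Q)) = (norm a - 1) / 2"
proof -
  have "(u - u * a - k) * (u - u * a - k) = 1 + a * a - a - a + k * k"
    by (simp add: algebra_simps u_simps)
  also have "\<dots> = 2 *\<^sub>R (1 - a)" by (simp add: a_square scaleR_2 algebra_simps)
  finally have "(matched_proj Q - Q) * (matched_proj Q - Q) = (1/2) *\<^sub>R (1 - a)"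
    by (simp add: matched_proj_minus)
  then show ?thesis using norm_a_minus_one by (simp add: norm_minus_commute)
qed

text \<open>\<open>a + k u\<close> and \<open>a - k u\<close> are mutually inverse and conjugate under \<open>u\<close>.\<close>

lemma norm_a_plus_k_mult_u_ge: "norm a + sqrt ((norm a)\<^sup>2 - 1) \<le> norm (a + k * u)"
proof -
  define w where "w = k * u"
  define r where "r = norm (a + w)"
  have w: "selfadjoint w" "w * w = a * a - 1" "a * w = w * a"
    by (simp_all add: w_def adj_mult selfadjoint_u skewadjoint_k mult.assoc u_simps a_square)
  have isometry: "adj u * u = 1" "u * adj u = 1" by (simp_all add: selfadjoint_u u_square)
  have "u * (a + w) * u = a - w"
    by (simp add: w_def algebra_simps u_simps)
  then have norm_conjugate: "norm (a - w) = r"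
    by (metis norm_isometry_mult norm_mult_coisometry isometry r_def)
  have sum: "(a + w) + (a - w) = 2 *\<^sub>R a" by (simp add: scaleR_2)
  have "norm (2 *\<^sub>R a) \<le> r + r"
    using norm_triangle_ineq[of "a + w" "a - w"] unfolding sum by (simp add: norm_conjugate r_def)
  then have a_le: "norm a \<le> r" by simp
  have "r * norm (2 *\<^sub>R a) \<le> r\<^sup>2 + 1"
    unfolding r_def sum[symmetric]
  proof (rule norm_mult_norm_add_inverse_le)
    show "selfadjoint (a + w)" "selfadjoint (a - w)" by (simp_all add: adj_simps selfadjoint_a w)
    show "(a + w) * (a - w) = 1" "(a - w) * (a + w) = 1" by (simp_all add: algebra_simps w)
    show "norm (a + w) = norm (a - w)" by (simp only: norm_conjugate r_def)
    show "positive_el ((a + w) + (a - w))" by (simp add: sum positive_el_scaleR positive_a)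
  qed
  then have "(norm a)\<^sup>2 - 1 \<le> (r - norm a)\<^sup>2" by (simp add: power2_diff algebra_simps)
  then have "sqrt ((norm a)\<^sup>2 - 1) \<le> r - norm a" using a_le by (intro real_le_lsqrt) auto
  then show ?thesis by (simp add: r_def w_def)
qed

lemma norm_matched_proj_minus:
  "norm (matched_proj Q - Q) = (norm a - 1 + sqrt ((norm a)\<^sup>2 - 1)) / 2"
proof -
  have coisometry: "u * adj u = 1" by (simp add: selfadjoint_u u_square)
  have "(u - u * a - k) * u = - (a - 1 + k * u)"
    by (simp add: algebra_simps u_simps)
  then have norm_eq: "norm (u - u * a - k) = norm (a - 1 + k * u)"
    by (metis norm_mult_coisometry coisometry norm_minus_cancel)
  have "norm (a - 1 + k * u) \<le> norm a - 1 + sqrt ((norm a)\<^sup>2 - 1)"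
    using norm_triangle_ineq[of "a - 1" "k * u"]
    by (simp add: norm_a_minus_one norm_mult_coisometry[OF coisometry] norm_k)
  moreover have "norm (a + k * u) - 1 \<le> norm (a - 1 + k * u)"
    using norm_triangle_ineq2[of "a + k * u" 1] by (simp add: algebra_simps)
  ultimately have "norm (a - 1 + k * u) = norm a - 1 + sqrt ((norm a)\<^sup>2 - 1)"
    using norm_a_plus_k_mult_u_ge by linarith
  then show ?thesis by (simp add: matched_proj_minus norm_eq)
qed

subsection \<open>Norms of the products\<close>

lemma norm_projection_mult_a_square:
  assumes "projection_el p" "off_diagonal p k" "Q \<noteq> R"
  shows "norm (p * (a * a)) = (norm a)\<^sup>2"
  unfolding norm_a_square a_square
  by (intro norm_projection_mult_one_minus_skew_square assms skewadjoint_k)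
    (use assms(3) in \<open>simp add: k_def\<close>)

lemma norm_Q_eq_norm_a:
  assumes "Q \<noteq> R"
  shows "norm Q = norm a"
proof -
  have "off_diagonal P k"
    by (simp add: k_def algebra_simps P_simps)
  then have "norm (Q * R) = (norm a)\<^sup>2"
    using norm_projection_mult_a_square[OF projection_P _ assms] by (simp add: P_mult_a_square)
  then show ?thesis by (simp add: norm_mult_adj)
qed

lemma norm_a_gt_one:
  assumes "Q \<noteq> R"
  shows "1 < norm a"
proof -
  have "1\<^sup>2 < (norm a)\<^sup>2" using assms by (simp add: norm_a_square k_def)
  then show ?thesis by (rule power2_less_imp_less) simp
qed

lemma norm_projection_mult_a_square_minus_a:
  assumes p: "projection_el p" and "off_diagonal p k" and "Q \<noteq> R"
  shows "norm (p * (a * a - a)) = norm a * (norm a - 1)"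
proof (rule antisym)
  have "norm (p * (a * a - a)) \<le> norm (a * (a - 1))"
    using norm_projection_mult_le[OF p, of "a * a - a"] by (simp add: right_diff_distrib)
  also have "\<dots> \<le> norm a * (norm a - 1)"
    using norm_mult_ineq[of a "a - 1"] by (simp add: norm_a_minus_one)
  finally show "norm (p * (a * a - a)) \<le> norm a * (norm a - 1)" .
  have "norm a * (norm a - 1) \<le> norm (p * (a * a)) - norm (p * a)"
    using norm_projection_mult_a_square[OF assms] norm_projection_mult_le[OF p, of a]
    by (simp add: power2_eq_square algebra_simps)
  also have "\<dots> \<le> norm (p * (a * a - a))" by (simp add: right_diff_distrib norm_triangle_ineq2)
  finally show "norm a * (norm a - 1) \<le> norm (p * (a * a - a))" .
qed

lemma one_minus_u_compression: "(1 - u) * (Q * R) * (1 - u) = (1 - u) * (a * a - a)"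
proof -
  have double: "2 *\<^sub>R (Q * R) = a * a + u * a + k * (u * a)"
    unfolding a_square_expand u_mult_a by (simp add: h_def k_def algebra_simps idem_simps scaleR_2)
  have "2 *\<^sub>R ((1 - u) * (Q * R) * (1 - u)) = (1 - u) * (2 *\<^sub>R (Q * R)) * (1 - u)" by simp
  also have "\<dots> = 2 *\<^sub>R ((1 - u) * (a * a - a))"
    unfolding double by (simp add: algebra_simps scaleR_2 u_simps)
  finally show ?thesis by simp
qed

lemma norm_one_minus_matched_proj_mult:
  assumes nonproj: "Q \<noteq> R"
  shows "norm ((1 - matched_proj Q) * Q) = sqrt 2 / 2 * sqrt (norm a * (norm a - 1))"
proof -
  let ?q = "1 - matched_proj Q"
  have q_eq: "?q = (1/2) *\<^sub>R (1 - u)"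
    using idempotent_el.matched_proj_eq[OF idempotent_el_one_minus]
    by (simp add: matched_proj_one_minus u_one_minus)
  have "off_diagonal ?q k"
    by (simp add: matched_proj_eq algebra_simps u_simps flip: scaleR_add_left)
  then have "norm (?q * (a * a - a)) = norm a * (norm a - 1)"
    by (intro norm_projection_mult_a_square_minus_a projection_el_complement
        projection_matched_proj nonproj)
  moreover have "(?q * Q) * adj (?q * Q) = (1/2) *\<^sub>R (?q * (a * a - a))"
    unfolding q_eq using one_minus_u_compression by (simp add: adj_simps selfadjoint_u mult.assoc)
  ultimately have "(norm (?q * Q))\<^sup>2 = norm a * (norm a - 1) / 2"
    by (simp flip: norm_mult_adj)
  then have "norm (?q * Q) = sqrt (norm a * (norm a - 1) / 2)"
    by (simp add: real_sqrt_unique)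
  also have "\<dots> = sqrt 2 / 2 * sqrt (norm a * (norm a - 1))"
    by (simp add: real_sqrt_divide field_simps)
  finally show ?thesis .
qed

lemma norm_mult_one_minus_matched_proj:
  assumes nonproj: "Q \<noteq> R"
  shows "norm (Q * (1 - matched_proj Q)) = sqrt 2 / 2 * sqrt (norm a * (norm a - 1))"
proof -
  have "norm (Q * (1 - matched_proj Q)) = norm ((1 - matched_proj R) * R)"
    using norm_adj[of "Q * (1 - matched_proj Q)"] projection_elD(1)[OF projection_matched_proj]
    by (simp add: adj_mult adj_diff matched_proj_adj)
  also have "\<dots> = sqrt 2 / 2 * sqrt (norm a * (norm a - 1))"
    using idempotent_el.norm_one_minus_matched_proj_mult[OF idempotent_el_adj] nonproj
    by (simp add: adj_adj a_adj)
  finally show ?thesis .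
qed

lemma norm_matched_proj_mult_one_minus:
  assumes nonproj: "Q \<noteq> R"
  shows "norm (matched_proj Q * (1 - Q)) = sqrt 2 / 2 * sqrt (norm a * (norm a - 1))"
  using idempotent_el.norm_one_minus_matched_proj_mult[OF idempotent_el_one_minus] nonproj
  by (simp add: adj_diff matched_proj_one_minus a_one_minus)

lemma norm_one_minus_mult_matched_proj:
  assumes nonproj: "Q \<noteq> R"
  shows "norm ((1 - Q) * matched_proj Q) = sqrt 2 / 2 * sqrt (norm a * (norm a - 1))"
  using idempotent_el.norm_mult_one_minus_matched_proj[OF idempotent_el_one_minus] nonproj
  by (simp add: adj_diff matched_proj_one_minus a_one_minus)

end

lemma norm_values_strictly_ordered:
  fixes n :: real
  assumes n: "1 < n"
  shows "sqrt 2 * ((n - 1) / 2) < sqrt 2 / 2 * sqrt (n * (n - 1))"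
    and "sqrt 2 / 2 * sqrt (n * (n - 1)) < (n - 1 + sqrt (n\<^sup>2 - 1)) / 2"
    and "(n - 1 + sqrt (n\<^sup>2 - 1)) / 2 < sqrt 2 * (sqrt 2 / 2 * sqrt (n * (n - 1)))"
proof -
  define s where "s = sqrt (n\<^sup>2 - 1)"
  have "1 < n\<^sup>2" using n by simp
  then have s: "0 < s" "s\<^sup>2 = n\<^sup>2 - 1" "s < n"
    using n by (auto simp: s_def intro: real_less_lsqrt)
  have square: "((n - 1 + s) / 2)\<^sup>2 = (n - 1) * (n + s) / 2"
    using s(2) by (simp add: power2_eq_square field_simps)
  have "n - 1 < sqrt (n * (n - 1))"
    using n by (intro real_less_rsqrt) (simp add: power2_eq_square)
  then show "sqrt 2 * ((n - 1) / 2) < sqrt 2 / 2 * sqrt (n * (n - 1))" by simp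
  have "sqrt 2 / 2 * sqrt (n * (n - 1)) = sqrt (n * (n - 1) / 2)"
    by (simp add: real_sqrt_divide field_simps)
  also have "\<dots> < (n - 1 + s) / 2"
    using n s by (intro real_less_lsqrt) (auto simp: square)
  finally show "sqrt 2 / 2 * sqrt (n * (n - 1)) < (n - 1 + sqrt (n\<^sup>2 - 1)) / 2"
    by (simp add: s_def)
  have "(n - 1) * (n + s) < (n - 1) * (2 * n)" using n s by (intro mult_strict_left_mono) auto
  then have "((n - 1 + s) / 2)\<^sup>2 < n * (n - 1)"
    unfolding square by (simp add: field_simps)
  then have "(n - 1 + s) / 2 < sqrt (n * (n - 1))" by (rule real_less_rsqrt)
  then show "(n - 1 + sqrt (n\<^sup>2 - 1)) / 2 < sqrt 2 * (sqrt 2 / 2 * sqrt (n * (n - 1)))"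
    by (simp add: s_def flip: mult.assoc)
qed

theorem theorem5p14:
  fixes Q :: "'a::cstar_algebra"
  assumes idem: "Q * Q = Q" and nonproj: "Q \<noteq> adj Q"
  defines "m \<equiv> matched_proj Q"
  defines "c \<equiv> sqrt 2 / 2 * sqrt (norm Q * (norm Q - 1))"
  shows "norm ((1 - m) * Q) = c \<and> norm (Q * (1 - m)) = c
       \<and> norm ((1 - Q) * m) = c \<and> norm (m * (1 - Q)) = c
       \<and> norm ((m - Q) * (m - Q)) = (norm Q - 1) / 2
       \<and> norm (m - Q) = (norm Q - 1 + sqrt ((norm Q)\<^sup>2 - 1)) / 2
       \<and> sqrt 2 * norm ((m - Q) * (m - Q)) < norm ((1 - m) * Q)
       \<and> norm ((1 - m) * Q) < norm (m - Q)
       \<and> norm (m - Q) < sqrt 2 * norm ((1 - m) * Q)"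
proof -
  interpret idempotent_el Q by (rule idempotent_el.intro) (rule idem)
  note norm_products = norm_one_minus_matched_proj_mult[OF nonproj]
    norm_mult_one_minus_matched_proj[OF nonproj] norm_one_minus_mult_matched_proj[OF nonproj]
    norm_matched_proj_mult_one_minus[OF nonproj]
  note norm_differences = norm_matched_proj_minus_square norm_matched_proj_minus
  show ?thesis
    unfolding m_def c_def norm_Q_eq_norm_a[OF nonproj] norm_products norm_differences
    using norm_values_strictly_ordered[OF norm_a_gt_one[OF nonproj]] by blast
qed

end
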